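(* Let $E$ and $\mathcal{X}$ be Polish spaces with $\mathcal{X}$ compact. Let $h:\mathcal{X}\times E\to\mathbb{R}$ be jointly continuous and bounded from below, and suppose its sub-level sets are compact. Let $q\in(1,\infty)$ and $\mu\in\mathcal{P}(E)$ be such that, with $\psi(w):=(\sup_{x\in\mathcal{X}}h(x,w))^+$, we have $\int_E\psi^q\,d\mu<\infty$. Let $\hat{x}:\mathcal{P}_\psi(E)\to\mathcal{X}$ be any measurable function satisfying $$\hat{x}(\nu)\in\arg\min_{x\in\mathcal{X}}\int_Eh(x,w)\,\nu(dw)\quad\text{for each }\nu\in\mathcal{P}_\psi(E).$$ Suppose there exist a measurable function $\varphi:\mathbb{R}\to\mathbb{R}$ and a metric $d$ on $\mathcal{X}$ generating its topology such that, for all $x\in\mathcal{X}$, $$\varphi(d(\hat{x}(\mu),x))\le\int_Eh(x,w)\,\mu(dw)-\int_Eh(\hat{x}(\mu),w)\,\mu(dw).$$ Then, for any $\epsilon>0$, $$\limsup_{n\to\infty}\,n^{q-1}\mu^n\big(\varphi(d(\hat{x}(\mu),\hat{x}(L_n)))\ge\epsilon\big)<\infty.$$ In particular, if $\varphi$ is strictly increasing with $\varphi(0)=0$, then for any $\epsilon>0$, $$\limsup_{n\to\infty}\,n^{q-1}\mu^n\big(d(\hat{x}(\mu),\hat{x}(L_n))\ge\epsilon\big)<\infty.$$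
   Context: $\mathcal{P}(E)$ is the set of Borel probability measures on $E$. $\mathcal{P}_\psi(E)=\{\nu\in\mathcal{P}(E):\int\psi\,d\nu<\infty\}$, with the topology generated by the maps $\nu\mapsto\int f\,d\nu$ with $f:E\to\mathbb{R}$ continuous, $|f|\le1+\psi$, and its Borel $\sigma$-field. $\mu^n$ is the $n$-fold product measure on $E^n$; $L_n(x_1,\dots,x_n)=\frac1n\sum_{i=1}^n\delta_{x_i}$; $a^+=\max(a,0)$. The sub-level sets of $h$ are $\{(x,w)\in\mathcal{X}\times E:h(x,w)\le c\}$, $c\in\mathbb{R}$. *)

theory Defs
  imports "HOL-Probability.Probability"
begin

definition pos_sup :: "('x \<Rightarrow> 'e \<Rightarrow> real) \<Rightarrow> 'e \<Rightarrow> real" where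
  "pos_sup h w = max (SUP x. h x w) 0"

definition prob_with_moment :: "('e::topological_space \<Rightarrow> real) \<Rightarrow> 'e measure set" where
  "prob_with_moment \<psi> =
     {\<nu> \<in> space (prob_algebra borel). (\<integral>\<^sup>+ w. ennreal (\<psi> w) \<partial>\<nu>) < \<infinity>}"

text \<open>The initial topology on the set \<^term>\<open>prob_with_moment \<psi>\<close> with respect to integration of the
  continuous functions dominated by \<open>1 + \<psi>\<close>, and its Borel \<open>\<sigma>\<close>-field. The measure assigned
  by \<^const>\<open>sigma\<close> is irrelevant; only its space and measurable sets are used.\<close>

definition psi_topology :: "('e::topological_space \<Rightarrow> real) \<Rightarrow> 'e measure topology" where
  "psi_topology \<psi> = topology_generated_by
     {{\<nu> \<in> prob_with_moment \<psi>. (\<integral>w. f w \<partial>\<nu>) \<in> U} | f U.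
        continuous_on UNIV f \<and> (\<forall>w. \<bar>f w\<bar> \<le> 1 + \<psi> w) \<and> open U}"

definition psi_borel :: "('e::topological_space \<Rightarrow> real) \<Rightarrow> 'e measure measure" where
  "psi_borel \<psi> = sigma (prob_with_moment \<psi>) {V. openin (psi_topology \<psi>) V}"

lemma topspace_psi_topology:
  assumes "\<And>w. 0 \<le> \<psi> w"
  shows "topspace (psi_topology \<psi>) = prob_with_moment \<psi>"
proof -
  have "prob_with_moment \<psi> \<in> {{\<nu> \<in> prob_with_moment \<psi>. (\<integral>w. f w \<partial>\<nu>) \<in> U} | f U.
        continuous_on UNIV f \<and> (\<forall>w. \<bar>f w\<bar> \<le> 1 + \<psi> w) \<and> open U}"
    by (rule CollectI, rule exI[of _ "\<lambda>_. 0"], rule exI[of _ UNIV])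
       (use assms in \<open>auto intro: add_nonneg_nonneg\<close>)
  then show ?thesis
    unfolding psi_topology_def topology_generated_by_topspace by blast
qed

text \<open>The measure \<open>(1/n) \<Sum>\<^sub>i \<delta>\<^bsub>x\<^sub>i\<^esub>\<close>, \<open>1 \<le> i \<le> n\<close>; for \<open>n = 0\<close> it is the null measure.\<close>

definition empirical_measure :: "nat \<Rightarrow> (nat \<Rightarrow> 'e::topological_space) \<Rightarrow> 'e measure" where
  "empirical_measure n x = measure_of UNIV (sets borel)
     (\<lambda>A. ennreal (1 / real n) * (\<Sum>i=1..n. emeasure (return borel (x i)) A))"

lemma sets_empirical_measure [simp]: "sets (empirical_measure n x) = sets borel"
  unfolding empirical_measure_def
  by (metis sets.sets_measure_of_eq space_borel)

lemma emeasure_empirical_measure: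
  assumes "A \<in> sets borel"
  shows "emeasure (empirical_measure n x) A =
           ennreal (1 / real n) * (\<Sum>i=1..n. emeasure (return borel (x i)) A)"
proof (rule emeasure_measure_of[OF empirical_measure_def])
  show "countably_additive (sets (empirical_measure n x))
          (\<lambda>A. ennreal (1 / real n) * (\<Sum>i=1..n. emeasure (return borel (x i)) A))"
  proof (rule countably_additiveI)
    fix F :: "nat \<Rightarrow> 'a set"
    assume F: "range F \<subseteq> sets (empirical_measure n x)" "disjoint_family F"
    have "(\<Sum>k. \<Sum>i=1..n. emeasure (return borel (x i)) (F k))
            = (\<Sum>i=1..n. \<Sum>k. emeasure (return borel (x i)) (F k))"
      by (rule suminf_sum) simp
    also have "\<dots> = (\<Sum>i=1..n. emeasure (return borel (x i)) (\<Union>k. F k))"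
      using F by (intro sum.cong refl suminf_emeasure) auto
    finally show "(\<Sum>k. ennreal (1 / real n) * (\<Sum>i=1..n. emeasure (return borel (x i)) (F k)))
        = ennreal (1 / real n) * (\<Sum>i=1..n. emeasure (return borel (x i)) (\<Union>k. F k))"
      by simp
  qed
qed (use assms in \<open>auto simp: positive_def\<close>)

end

theory Submission
  imports Defs "HOL-Real_Asymp.Real_Asymp"
begin

text \<open>
  Write \<open>F x = \<integral> h x d\<mu>\<close> and \<open>F\<^sub>n x = (1/n) \<Sum>\<^sub>i h x (\<omega>\<^sub>i)\<close>, which is the integral of
  \<open>h x\<close> against the empirical measure. Let \<open>x\<close> be the minimiser chosen for \<open>\<mu>\<close> and \<open>x\<^sub>n\<close> the one
  chosen for the empirical measure. The hypothesis on \<open>\<phi>\<close> bounds \<open>\<phi> (d x x\<^sub>n)\<close> by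
  \<open>F x\<^sub>n - F x\<close>, and since \<open>F\<^sub>n x\<^sub>n \<le> F\<^sub>n x\<close> this is at most
  \<open>(F x\<^sub>n - F\<^sub>n x\<^sub>n) + (F\<^sub>n x - F x)\<close>. So if \<open>\<phi> (d x x\<^sub>n) \<ge> \<epsilon>\<close>, then \<open>F\<^sub>n\<close> and \<open>F\<close> differ by
  at least \<open>\<epsilon>/2\<close> somewhere, and it suffices to prove a uniform law of large numbers
  with rate \<open>n\<^sup>1\<^sup>-\<^sup>q\<close> (\<open>uniform_empirical_mean_tail\<close>).

  Uniformity comes from compactness. The oscillation of \<open>h _ w\<close> on a ball around \<open>x\<close>
  is dominated by a function in \<open>L\<^sup>q\<close> and tends to \<open>0\<close> pointwise as the ball shrinks, so
  its mean is small for a small enough ball. Finitely many such balls cover the space, and \<open>F\<^sub>n\<close>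
  is uniformly close to \<open>F\<close> as soon as the empirical means of the finitely many
  functions \<open>h x\<close> and oscillations at the centres are close to their expectations.

  For a single \<open>Z\<close> in \<open>L\<^sup>q\<close> the rate (\<open>empirical_mean_upper_tail\<close>) is obtained by
  truncating \<open>Z\<close> at height \<open>c n\<close>. Some summand exceeds that height with
  probability at most \<open>n E |Z|\<^sup>q / (c n)\<^sup>q\<close>, which has the right order. The truncated sum is
  handled by the exponential Markov inequality with parameter \<open>\<theta> = a ln n / n\<close>: the gain
  \<open>exp (- \<theta> n \<delta> / 2)\<close> is exactly a power of \<open>n\<close>, and the choice of \<open>a\<close> makes it
  \<open>n\<^sup>1\<^sup>-\<^sup>q\<close>. As \<open>\<theta> c n = a c ln n\<close>, the truncation lets the exponential moment
  exceed its linear approximation by at most a small power of \<open>n\<close> times \<open>\<theta>\<^sup>s\<close>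
  with \<open>s = min q 2 > 1\<close>, and this is \<open>o(\<theta>)\<close> when \<open>c\<close> is small.
\<close>

section \<open>Sequences of events of polynomially decaying probability\<close>

text \<open>
  The measurable cover \<open>B\<close> is part of the notion because the events of interest involve an
  uncountable union over the decision space, or an arbitrary selection of minimisers, and
  need not be measurable.
\<close>

definition polynomially_rare :: "(nat \<Rightarrow> 'a measure) \<Rightarrow> real \<Rightarrow> (nat \<Rightarrow> 'a set) \<Rightarrow> bool" where
  "polynomially_rare P r A \<longleftrightarrow> (\<exists>C B. \<forall>\<^sub>F n in sequentially.
     A n \<subseteq> B n \<and> B n \<in> sets (P n) \<and> measure (P n) (B n) \<le> C * real n powr - r)"

lemma polynomially_rare_subset:
  assumes "polynomially_rare P r B" "\<forall>\<^sub>F n in sequentially. A n \<subseteq> B n"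
  shows "polynomially_rare P r A"
proof -
  obtain C D where "\<forall>\<^sub>F n in sequentially.
     B n \<subseteq> D n \<and> D n \<in> sets (P n) \<and> measure (P n) (D n) \<le> C * real n powr - r"
    using assms(1) unfolding polynomially_rare_def by blast
  with assms(2) have "\<forall>\<^sub>F n in sequentially.
     A n \<subseteq> D n \<and> D n \<in> sets (P n) \<and> measure (P n) (D n) \<le> C * real n powr - r"
    by eventually_elim blast
  then show ?thesis unfolding polynomially_rare_def by blast
qed

lemma polynomially_rare_Un:
  assumes "polynomially_rare P r A" "polynomially_rare P r A'"
  shows "polynomially_rare P r (\<lambda>n. A n \<union> A' n)"
proof -
  obtain C B where 1: "\<forall>\<^sub>F n in sequentially.
     A n \<subseteq> B n \<and> B n \<in> sets (P n) \<and> measure (P n) (B n) \<le> C * real n powr - r"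
    using assms(1) unfolding polynomially_rare_def by blast
  obtain C' B' where 2: "\<forall>\<^sub>F n in sequentially.
     A' n \<subseteq> B' n \<and> B' n \<in> sets (P n) \<and> measure (P n) (B' n) \<le> C' * real n powr - r"
    using assms(2) unfolding polynomially_rare_def by blast
  from 1 2 have "\<forall>\<^sub>F n in sequentially. A n \<union> A' n \<subseteq> B n \<union> B' n \<and> B n \<union> B' n \<in> sets (P n) \<and>
     measure (P n) (B n \<union> B' n) \<le> (C + C') * real n powr - r"
  proof eventually_elim
    case (elim n)
    have "measure (P n) (B n \<union> B' n) \<le> measure (P n) (B n) + measure (P n) (B' n)"
      using elim by (intro measure_Un_le) auto
    with elim show ?case by (auto simp: distrib_right)
  qed
  then show ?thesis
    unfolding polynomially_rare_def
    by (intro exI[of _ "C + C'"] exI[of _ "\<lambda>n. B n \<union> B' n"])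
qed

lemma polynomially_rare_UN:
  assumes "finite T" "\<And>t. t \<in> T \<Longrightarrow> polynomially_rare P r (A t)"
  shows "polynomially_rare P r (\<lambda>n. \<Union>t\<in>T. A t n)"
  using assms
proof (induction T)
  case empty
  show ?case
    unfolding polynomially_rare_def by (rule exI[of _ 0], rule exI[of _ "\<lambda>_. {}"]) auto
next
  case (insert t T)
  then show ?case
    using polynomially_rare_Un[of P r "A t" "\<lambda>n. \<Union>t\<in>T. A t n"] by simp
qed

text \<open>
  An event \<open>A n\<close> that is not measurable causes no harm: \<open>measure\<close> gives it the value \<open>0\<close>,
  and monotonicity only asks the larger set to be measurable.
\<close>

lemma polynomially_rare_imp_limsup_finite:
  assumes P: "\<And>n. finite_measure (P n)" and A: "polynomially_rare P r A"
  shows "limsup (\<lambda>n. ereal (real n powr r * measure (P n) (A n))) < \<infinity>"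
proof -
  obtain C B where "\<forall>\<^sub>F n in sequentially.
     A n \<subseteq> B n \<and> B n \<in> sets (P n) \<and> measure (P n) (B n) \<le> C * real n powr - r"
    using A unfolding polynomially_rare_def by blast
  then have "\<forall>\<^sub>F n in sequentially. ereal (real n powr r * measure (P n) (A n)) \<le> ereal C"
    using eventually_gt_at_top[of 0]
  proof eventually_elim
    case (elim n)
    have "measure (P n) (A n) \<le> measure (P n) (B n)"
      using elim by (intro finite_measure.finite_measure_mono[OF P]) auto
    also have "\<dots> \<le> C * real n powr - r"
      using elim by simp
    finally have "real n powr r * measure (P n) (A n) \<le> real n powr r * (C * real n powr - r)"
      by (intro mult_left_mono) auto
    also have "\<dots> = C"
      using \<open>0 < n\<close> by (simp add: powr_minus)
    finally show ?case by simp
  qed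
  then have "limsup (\<lambda>n. ereal (real n powr r * measure (P n) (A n))) \<le> ereal C"
    by (rule Limsup_bounded)
  then show ?thesis by (rule le_less_trans) simp
qed

section \<open>Tails of the sum of a truncated sample\<close>

text \<open>
  The exponent \<open>s\<close> interpolates between the quadratic Taylor remainder, which is the sharp one
  near \<open>0\<close>, and the linear growth for large negative \<open>u\<close>. Requiring only a moment of
  order \<open>s\<close> rather than a second moment is what allows \<open>q < 2\<close> later.
\<close>

lemma exp_le_one_plus_powr:
  fixes u s :: real
  assumes s: "1 \<le> s" "s \<le> 2"
  shows "exp u \<le> 1 + u + \<bar>u\<bar> powr s * exp (max u 0)"
proof -
  consider "\<bar>u\<bar> \<le> 1" | "1 < u" | "u < - 1" by linarith
  then show ?thesis
  proof cases
    case 1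
    have "exp u \<le> 1 + u + u\<^sup>2"
    proof (cases "0 \<le> u")
      case True then show ?thesis using exp_bound[of u] 1 by simp
    next
      case False
      \<comment> \<open>The product is \<open>1 - u\<^sup>3\<close>, and \<open>1 - u \<le> exp (- u)\<close>.\<close>
      have "1 \<le> (1 - u) * (1 + u + u\<^sup>2)"
        using False mult_nonneg_nonpos[of "u * u" u] by (simp add: algebra_simps power2_eq_square)
      also have "\<dots> \<le> exp (- u) * (1 + u + u\<^sup>2)"
        using 1 exp_ge_add_one_self[of "- u"] by (intro mult_right_mono) auto
      finally show ?thesis by (simp add: exp_minus field_simps)
    qed
    also have "u\<^sup>2 = \<bar>u\<bar> powr 2" by simp
    also have "\<bar>u\<bar> powr 2 \<le> \<bar>u\<bar> powr s * 1"
    proof (cases "u = 0")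
      case False then show ?thesis using 1 s by (simp add: powr_mono' del: powr_numeral)
    qed simp
    also have "\<dots> \<le> \<bar>u\<bar> powr s * exp (max u 0)"
      by (intro mult_left_mono) auto
    finally show ?thesis by simp
  next
    case 2
    then have "1 * exp u \<le> \<bar>u\<bar> powr s * exp (max u 0)"
      using s by (intro mult_mono) (auto simp: ge_one_powr_ge_zero)
    with 2 have "exp u \<le> \<bar>u\<bar> powr s * exp (max u 0)" by (simp only: mult_1)
    then show ?thesis using 2 by linarith
  next
    case 3
    have "exp u \<le> 1" using 3 by simp
    moreover have "- u \<le> \<bar>u\<bar> powr s"
      using 3 s powr_mono[of 1 s "\<bar>u\<bar>"] by simp
    ultimately have "exp u \<le> 1 + u + \<bar>u\<bar> powr s" by linarith
    then show ?thesis using 3 by simp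
  qed
qed

lemma (in prob_space) integrable_powr_mono:
  fixes f :: "'a \<Rightarrow> real"
  assumes [measurable]: "f \<in> borel_measurable M"
    and int: "integrable M (\<lambda>w. \<bar>f w\<bar> powr q)" and "0 \<le> s" "s \<le> q"
  shows "integrable M (\<lambda>w. \<bar>f w\<bar> powr s)"
proof (rule Bochner_Integration.integrable_bound)
  show "integrable M (\<lambda>w. 1 + \<bar>f w\<bar> powr q)"
    using int by auto
  have "x powr s \<le> 1 + x powr q" if "0 \<le> x" for x :: real
  proof (cases "x \<le> 1")
    case True
    then show ?thesis using that assms powr_le1[of s x] by (simp add: add_increasing2)
  next
    case False
    then have "x powr s \<le> x powr q" using assms by (intro powr_mono) auto
    then show ?thesis by simp
  qed
  then show "AE w in M. norm (\<bar>f w\<bar> powr s) \<le> norm (1 + \<bar>f w\<bar> powr q)"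
    by (auto intro!: AE_I2)
qed simp

text \<open>
  Truncation from above is one-sided: it decreases the mean, so the linear term of the bound can
  still be written with the mean of \<open>Z\<close>, and it bounds the exponential factor of
  \<open>exp_le_one_plus_powr\<close> by \<open>exp (\<theta> * c)\<close>.
\<close>

lemma (in prob_space) truncated_exp_moment_le:
  fixes Z :: "'a \<Rightarrow> real"
  assumes [measurable]: "Z \<in> borel_measurable M"
    and int: "integrable M Z" "integrable M (\<lambda>w. \<bar>Z w\<bar> powr s)"
    and s: "1 \<le> s" "s \<le> 2" and pos: "0 \<le> \<theta>" "0 \<le> c"
  shows "integrable M (\<lambda>w. exp (\<theta> * min (Z w) c))"
    and "(\<integral>w. exp (\<theta> * min (Z w) c) \<partial>M)
      \<le> exp (\<theta> * (\<integral>w. Z w \<partial>M) + \<theta> powr s * exp (\<theta> * c) * (\<integral>w. \<bar>Z w\<bar> powr s \<partial>M))"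
proof -
  show i: "integrable M (\<lambda>w. exp (\<theta> * min (Z w) c))"
  proof (rule Bochner_Integration.integrable_bound)
    show "integrable M (\<lambda>_. exp (\<theta> * c))" by simp
    show "AE w in M. norm (exp (\<theta> * min (Z w) c)) \<le> norm (exp (\<theta> * c))"
      using pos by (auto intro!: AE_I2 mult_left_mono)
  qed simp
  let ?b = "\<lambda>w. 1 + \<theta> * min (Z w) c + \<theta> powr s * exp (\<theta> * c) * \<bar>Z w\<bar> powr s"
  let ?e = "\<theta> * (\<integral>w. Z w \<partial>M) + \<theta> powr s * exp (\<theta> * c) * (\<integral>w. \<bar>Z w\<bar> powr s \<partial>M)"
  have min_int: "integrable M (\<lambda>w. min (Z w) c)"
    using int(1) by (intro integrable_min) auto
  have bound: "exp (\<theta> * min (Z w) c) \<le> ?b w" for w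
  proof -
    let ?u = "\<theta> * min (Z w) c"
    have "\<bar>?u\<bar> powr s \<le> (\<theta> * \<bar>Z w\<bar>) powr s"
      using s pos by (intro powr_mono2) (auto simp: abs_mult intro!: mult_left_mono)
    also have "\<dots> = \<theta> powr s * \<bar>Z w\<bar> powr s"
      using pos by (simp add: powr_mult)
    finally have 1: "\<bar>?u\<bar> powr s \<le> \<theta> powr s * \<bar>Z w\<bar> powr s" .
    have "?u \<le> \<theta> * c" using pos by (intro mult_left_mono) auto
    then have 2: "exp (max ?u 0) \<le> exp (\<theta> * c)" using pos by simp
    have "exp ?u \<le> 1 + ?u + \<bar>?u\<bar> powr s * exp (max ?u 0)"
      by (rule exp_le_one_plus_powr[OF s])
    also have "\<bar>?u\<bar> powr s * exp (max ?u 0) \<le> (\<theta> powr s * \<bar>Z w\<bar> powr s) * exp (\<theta> * c)"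
      by (intro mult_mono 1 2) auto
    finally show ?thesis by (simp add: mult_ac)
  qed
  have "(\<integral>w. exp (\<theta> * min (Z w) c) \<partial>M) \<le> (\<integral>w. ?b w \<partial>M)"
    using i bound min_int int(2) by (intro integral_mono) auto
  also have "\<dots> = 1 + \<theta> * (\<integral>w. min (Z w) c \<partial>M)
      + \<theta> powr s * exp (\<theta> * c) * (\<integral>w. \<bar>Z w\<bar> powr s \<partial>M)"
    using min_int int(2) by (simp add: prob_space)
  also have "\<dots> \<le> 1 + ?e"
    using pos min_int int(1) by (auto intro!: mult_left_mono integral_mono)
  also have "\<dots> \<le> exp ?e"
    by (rule exp_ge_add_one_self)
  finally show "(\<integral>w. exp (\<theta> * min (Z w) c) \<partial>M) \<le> exp ?e" .
qed

lemma (in prob_space) prod_sum_Chernoff: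
  fixes Y :: "'a \<Rightarrow> real"
  assumes [measurable]: "Y \<in> borel_measurable M"
    and int: "integrable M (\<lambda>w. exp (\<theta> * Y w))" and \<theta>: "0 \<le> \<theta>"
  shows "measure (\<Pi>\<^sub>M i\<in>{1..n}. M) {\<omega> \<in> space (\<Pi>\<^sub>M i\<in>{1..n}. M). y \<le> (\<Sum>i=1..n. Y (\<omega> i))}
    \<le> (\<integral>w. exp (\<theta> * Y w) \<partial>M) ^ n / exp (\<theta> * y)"
proof -
  let ?P = "\<Pi>\<^sub>M i\<in>{1..n::nat}. M"
  interpret product_sigma_finite "\<lambda>_::nat. M"
    by (rule product_sigma_finite.intro) (rule sigma_finite_measure_axioms)
  interpret P: prob_space ?P by (rule prob_space_PiM) (rule prob_space_axioms)
  have [measurable]: "(\<lambda>\<omega>. Y (\<omega> i)) \<in> borel_measurable ?P" if "i \<in> {1..n}" for i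
    using that by measurable
  have int': "integrable ?P (\<lambda>\<omega>. \<Prod>i\<in>{1..n}. exp (\<theta> * Y (\<omega> i)))"
    by (rule product_integrable_prod) (auto intro: int)
  have "measure ?P {\<omega> \<in> space ?P. y \<le> (\<Sum>i=1..n. Y (\<omega> i))}
      \<le> measure ?P {\<omega> \<in> space ?P. exp (\<theta> * y) \<le> (\<Prod>i\<in>{1..n}. exp (\<theta> * Y (\<omega> i)))}"
    by (intro P.finite_measure_mono)
       (auto simp: exp_sum[symmetric] sum_distrib_left[symmetric] intro: mult_left_mono[OF _ \<theta>])
  also have "\<dots> \<le> (\<integral>\<omega>. (\<Prod>i\<in>{1..n}. exp (\<theta> * Y (\<omega> i))) \<partial>?P) / exp (\<theta> * y)"
    by (rule integral_Markov_inequality_measure[OF int' sets.top]) (auto intro!: prod_nonneg)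
  also have "(\<integral>\<omega>. (\<Prod>i\<in>{1..n}. exp (\<theta> * Y (\<omega> i))) \<partial>?P) = (\<integral>w. exp (\<theta> * Y w) \<partial>M) ^ n"
    by (subst product_integral_prod) (auto intro: int)
  finally show ?thesis .
qed

lemma (in prob_space) prod_exceedance_le:
  fixes Z :: "'a \<Rightarrow> real"
  assumes [measurable]: "Z \<in> borel_measurable M"
    and int: "integrable M (\<lambda>w. \<bar>Z w\<bar> powr q)" and "0 < c" "0 \<le> q"
  shows "measure (\<Pi>\<^sub>M i\<in>{1..n}. M) {\<omega> \<in> space (\<Pi>\<^sub>M i\<in>{1..n}. M). \<exists>i\<in>{1..n}. c < Z (\<omega> i)}
    \<le> real n * ((\<integral>w. \<bar>Z w\<bar> powr q \<partial>M) / c powr q)"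
proof -
  let ?P = "\<Pi>\<^sub>M i\<in>{1..n::nat}. M"
  interpret P: prob_space ?P by (rule prob_space_PiM) (rule prob_space_axioms)
  have [measurable]: "(\<lambda>\<omega>. Z (\<omega> i)) \<in> borel_measurable ?P" if "i \<in> {1..n}" for i
    using that by measurable
  have one: "measure ?P {\<omega> \<in> space ?P. c < Z (\<omega> i)} \<le> (\<integral>w. \<bar>Z w\<bar> powr q \<partial>M) / c powr q"
    if i: "i \<in> {1..n}" for i
  proof -
    have "(\<lambda>\<omega>. \<omega> i) -` {w \<in> space M. c < Z w} \<inter> space ?P = {\<omega> \<in> space ?P. c < Z (\<omega> i)}"
      using i by (auto simp: space_PiM PiE_iff extensional_def)
    then have "measure ?P {\<omega> \<in> space ?P. c < Z (\<omega> i)}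
        = measure (distr ?P M (\<lambda>\<omega>. \<omega> i)) {w \<in> space M. c < Z w}"
      using i by (subst measure_distr) auto
    also have "\<dots> = measure M {w \<in> space M. c < Z w}"
      using i by (subst distr_PiM_component) (auto simp: prob_space_axioms)
    also have "\<dots> \<le> measure M {w \<in> space M. c powr q \<le> \<bar>Z w\<bar> powr q}"
      using assms by (intro finite_measure_mono) (auto intro!: powr_mono2)
    also have "\<dots> \<le> (\<integral>w. \<bar>Z w\<bar> powr q \<partial>M) / c powr q"
      using \<open>0 < c\<close> by (intro integral_Markov_inequality_measure[OF int sets.top]) auto
    finally show ?thesis .
  qed
  have "{\<omega> \<in> space ?P. \<exists>i\<in>{1..n}. c < Z (\<omega> i)} = (\<Union>i\<in>{1..n}. {\<omega> \<in> space ?P. c < Z (\<omega> i)})"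
    by auto
  also have "measure ?P \<dots> \<le> (\<Sum>i\<in>{1..n}. measure ?P {\<omega> \<in> space ?P. c < Z (\<omega> i)})"
    by (intro measure_UNION_le) auto
  also have "\<dots> \<le> (\<Sum>i\<in>{1..n}. (\<integral>w. \<bar>Z w\<bar> powr q \<partial>M) / c powr q)"
    by (intro sum_mono one)
  finally show ?thesis by simp
qed

section \<open>Polynomial rate in the law of large numbers\<close>

text \<open>
  With \<open>\<theta> = a ln n / n\<close> and truncation height \<open>(t/(2a)) n\<close>, the error term in
  \<open>truncated_exp_moment_le\<close> (for \<open>s = 1 + t\<close>), divided by \<open>\<theta>\<close>, is the expression below.
  It is of order \<open>(ln n)\<^sup>t n\<^sup>-\<^sup>t\<^sup>/\<^sup>2\<close>.
\<close>

lemma scale_cutoff_error_small: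
  fixes a t K \<eta> :: real
  assumes "0 < a" "0 < t" "0 < \<eta>"
  shows "\<forall>\<^sub>F n in sequentially. (a * ln (real n) / real n) powr t * real n powr (t / 2) * K \<le> \<eta>"
proof -
  have "(\<lambda>n. (a * ln (real n) / real n) powr t * real n powr (t / 2) * K) \<longlonglongrightarrow> 0"
    using assms by real_asymp
  then show ?thesis
    using assms(3) by (intro eventually_mono[OF order_tendstoD(2)[of _ 0 _ \<eta>]]) auto
qed

text \<open>
  Markov's inequality for the \<open>q\<close>-th moment of the sum would give only \<open>n powr (- q / 2)\<close> when
  \<open>q > 2\<close>. Splitting off the event that a single observation is of order \<open>n\<close> gives the rate
  \<open>n powr (1 - q)\<close> for all \<open>q > 1\<close> at once.
\<close>

lemma (in prob_space) empirical_mean_upper_tail: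
  fixes Z :: "'a \<Rightarrow> real"
  assumes Z [measurable]: "Z \<in> borel_measurable M"
    and int: "integrable M (\<lambda>w. \<bar>Z w\<bar> powr q)" and q: "1 < q" and \<delta>: "0 < \<delta>"
  shows "polynomially_rare (\<lambda>n. \<Pi>\<^sub>M i\<in>{1..n}. M) (q - 1)
    (\<lambda>n. {\<omega> \<in> space (\<Pi>\<^sub>M i\<in>{1..n}. M). (\<integral>w. Z w \<partial>M) + \<delta> \<le> (\<Sum>i=1..n. Z (\<omega> i)) / real n})"
proof -
  \<comment> \<open>The value of \<open>a\<close> makes \<open>exp (- a ln n \<delta> / 2)\<close> equal to \<open>n powr - (q - 1)\<close>; the value of \<open>c\<close>
      makes \<open>exp (\<theta> c n)\<close> equal to \<open>n powr (t / 2)\<close>, half the power that \<open>\<theta> powr t\<close> gains.\<close>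
  define s t a c where "s = min q 2" and "t = s - 1" and "a = 2 * (q - 1) / \<delta>" and "c = t / (2 * a)"
  have s: "1 < s" "s \<le> 2" "s \<le> q" and t: "0 < t" and a: "0 < a" and c: "0 < c"
    using q \<delta> by (auto simp: s_def t_def a_def c_def)
  define m K J where "m = (\<integral>w. Z w \<partial>M)" and "K = (\<integral>w. \<bar>Z w\<bar> powr s \<partial>M)"
    and "J = (\<integral>w. \<bar>Z w\<bar> powr q \<partial>M)"
  have ints: "integrable M (\<lambda>w. \<bar>Z w\<bar> powr s)"
    using s by (intro integrable_powr_mono[OF Z int]) auto
  have "integrable M (\<lambda>w. \<bar>Z w\<bar> powr 1)"
    using q by (intro integrable_powr_mono[OF Z int]) auto
  then have int1: "integrable M Z"
    by (intro integrable_abs_cancel[of M Z]) auto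
  let ?P = "\<lambda>n. \<Pi>\<^sub>M i\<in>{1..n::nat}. M"
  let ?A = "\<lambda>n. {\<omega> \<in> space (?P n). m + \<delta> \<le> (\<Sum>i=1..n. Z (\<omega> i)) / real n}"
  have "\<forall>\<^sub>F n in sequentially.
    (a * ln (real n) / real n) powr t * real n powr (t / 2) * K \<le> \<delta> / 2"
    using a t \<delta> by (intro scale_cutoff_error_small) auto
  then have "\<forall>\<^sub>F n in sequentially. ?A n \<subseteq> ?A n \<and> ?A n \<in> sets (?P n) \<and>
    measure (?P n) (?A n) \<le> (1 + J / c powr q) * real n powr - (q - 1)"
    using eventually_gt_at_top[of 1]
  proof eventually_elim
    case (elim n)
    then have n: "1 < n" by simp
    interpret P: prob_space "?P n" by (rule prob_space_PiM) (rule prob_space_axioms)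
    have [measurable]: "(\<lambda>\<omega>. Z (\<omega> i)) \<in> borel_measurable (?P n)" if "i \<in> {1..n}" for i
      using that by measurable
    define \<theta> where "\<theta> = a * ln (real n) / real n"
    have \<theta>: "0 < \<theta>" using a n by (simp add: \<theta>_def)
    let ?E = "{\<omega> \<in> space (?P n). \<exists>i\<in>{1..n}. c * real n < Z (\<omega> i)}"
    let ?T = "{\<omega> \<in> space (?P n). real n * (m + \<delta>) \<le> (\<Sum>i=1..n. min (Z (\<omega> i)) (c * real n))}"
    have sub: "?A n \<subseteq> ?E \<union> ?T"
    proof
      fix \<omega> assume \<omega>: "\<omega> \<in> ?A n"
      show "\<omega> \<in> ?E \<union> ?T"
      proof (cases "\<omega> \<in> ?E")
        case False
        with \<omega> have "min (Z (\<omega> i)) (c * real n) = Z (\<omega> i)" if "i \<in> {1..n}" for i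
          using that by (auto simp: min_def not_less)
        then have "(\<Sum>i=1..n. min (Z (\<omega> i)) (c * real n)) = (\<Sum>i=1..n. Z (\<omega> i))"
          by (intro sum.cong) auto
        with \<omega> n show ?thesis by (auto simp: field_simps)
      qed simp
    qed
    have "measure (?P n) ?E \<le> real n * (J / (c * real n) powr q)"
      unfolding J_def using n c q by (intro prod_exceedance_le int) auto
    also have "\<dots> = J / c powr q * real n powr - (q - 1)"
    proof -
      have "real n powr - (q - 1) = real n / real n powr q"
        using n powr_diff[of "real n" 1 q] by simp
      then show ?thesis using c by (simp add: powr_mult)
    qed
    finally have E: "measure (?P n) ?E \<le> J / c powr q * real n powr - (q - 1)" .
    have ac: "a * c = t / 2" using a by (simp add: c_def)
    have "\<theta> * (c * real n) = (a * c) * ln (real n)"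
      using n by (simp add: \<theta>_def)
    then have "exp (\<theta> * (c * real n)) = real n powr (t / 2)"
      using n unfolding ac by (simp add: powr_def)
    moreover have "\<theta> powr s = \<theta> * \<theta> powr t"
      using \<theta> by (simp add: t_def powr_diff)
    ultimately have "\<theta> powr s * exp (\<theta> * (c * real n)) * K = \<theta> * (\<theta> powr t * real n powr (t / 2) * K)"
      by simp
    also have "\<dots> \<le> \<theta> * (\<delta> / 2)"
      using elim(1) \<theta> by (intro mult_left_mono) (auto simp: \<theta>_def)
    finally have err: "\<theta> powr s * exp (\<theta> * (c * real n)) * K \<le> \<theta> * (\<delta> / 2)" .
    note trunc = truncated_exp_moment_le[OF Z int1 ints, of \<theta> "c * real n"]
    have "(\<integral>w. exp (\<theta> * min (Z w) (c * real n)) \<partial>M)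
        \<le> exp (\<theta> * m + \<theta> powr s * exp (\<theta> * (c * real n)) * K)"
      unfolding m_def K_def using s \<theta> c by (intro trunc(2)) auto
    also have "\<dots> \<le> exp (\<theta> * (m + \<delta> / 2))"
      using err by (simp add: distrib_left)
    finally have mgf: "(\<integral>w. exp (\<theta> * min (Z w) (c * real n)) \<partial>M) \<le> exp (\<theta> * (m + \<delta> / 2))" .
    have "measure (?P n) ?T
        \<le> (\<integral>w. exp (\<theta> * min (Z w) (c * real n)) \<partial>M) ^ n / exp (\<theta> * (real n * (m + \<delta>)))"
      using s \<theta> c by (intro prod_sum_Chernoff trunc(1)) auto
    also have "\<dots> \<le> exp (\<theta> * (m + \<delta> / 2)) ^ n / exp (\<theta> * (real n * (m + \<delta>)))"
      using mgf by (intro divide_right_mono power_mono) auto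
    also have "\<dots> = exp (- (\<theta> * real n * \<delta> / 2))"
    proof -
      have "real n * (\<theta> * (m + \<delta> / 2)) - \<theta> * (real n * (m + \<delta>)) = - (\<theta> * real n * \<delta> / 2)"
        by (simp add: algebra_simps)
      then show ?thesis
        by (simp only: exp_of_nat_mult[symmetric] exp_diff[symmetric])
    qed
    also have "\<theta> * real n * \<delta> / 2 = (q - 1) * ln (real n)"
      using n \<delta> by (simp add: \<theta>_def a_def)
    also have "exp (- ((q - 1) * ln (real n))) = real n powr - (q - 1)"
      using n by (simp add: powr_def left_diff_distrib)
    finally have T: "measure (?P n) ?T \<le> real n powr - (q - 1)" .
    have "measure (?P n) (?A n) \<le> measure (?P n) (?E \<union> ?T)"
      by (rule P.finite_measure_mono[OF sub]) measurable
    also have "\<dots> \<le> measure (?P n) ?E + measure (?P n) ?T"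
      by (intro measure_Un_le) measurable
    also have "\<dots> \<le> (1 + J / c powr q) * real n powr - (q - 1)"
      using E T by (simp add: distrib_right)
    finally show ?case by auto
  qed
  then show ?thesis
    unfolding polynomially_rare_def m_def
    by (intro exI[of _ "1 + J / c powr q"] exI)
qed

lemma (in prob_space) empirical_mean_tail:
  fixes Z :: "'a \<Rightarrow> real"
  assumes Z: "Z \<in> borel_measurable M"
    and int: "integrable M (\<lambda>w. \<bar>Z w\<bar> powr q)" and q: "1 < q" and \<delta>: "0 < \<delta>"
  shows "polynomially_rare (\<lambda>n. \<Pi>\<^sub>M i\<in>{1..n}. M) (q - 1)
    (\<lambda>n. {\<omega> \<in> space (\<Pi>\<^sub>M i\<in>{1..n}. M). \<delta> \<le> \<bar>(\<Sum>i=1..n. Z (\<omega> i)) / real n - (\<integral>w. Z w \<partial>M)\<bar>})"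
proof (rule polynomially_rare_subset)
  let ?up = "\<lambda>Z n. {\<omega> \<in> space (\<Pi>\<^sub>M i\<in>{1..n}. M).
    (\<integral>w. Z w \<partial>M) + \<delta> \<le> (\<Sum>i=1..n. Z (\<omega> i)) / real n}"
  show "polynomially_rare (\<lambda>n. \<Pi>\<^sub>M i\<in>{1..n}. M) (q - 1) (\<lambda>n. ?up Z n \<union> ?up (\<lambda>w. - Z w) n)"
    by (intro polynomially_rare_Un empirical_mean_upper_tail) (use assms in auto)
qed (auto intro!: always_eventually simp: sum_negf)

section \<open>Uniformity over a compact parameter space\<close>

text \<open>
  A supremum of an uncountable family of Borel functions need not be Borel, but a supremum of
  continuous functions is lower semicontinuous.
\<close>

lemma borel_measurable_SUP_continuous:
  fixes f :: "'i \<Rightarrow> 'e::topological_space \<Rightarrow> real"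
  assumes "I \<noteq> {}" and cont: "\<And>i. i \<in> I \<Longrightarrow> continuous_on UNIV (f i)"
    and bdd: "\<And>w. bdd_above ((\<lambda>i. f i w) ` I)"
  shows "(\<lambda>w. SUP i\<in>I. f i w) \<in> borel_measurable borel"
proof -
  have "{w. a < (SUP i\<in>I. f i w)} = (\<Union>i\<in>I. {w. a < f i w})" for a
    using less_cSUP_iff[OF \<open>I \<noteq> {}\<close> bdd] by auto
  moreover have "open (\<Union>i\<in>I. {w. a < f i w})" for a
    using cont by (intro open_UN ballI open_Collect_less continuous_on_const) auto
  ultimately show ?thesis
    by (auto simp: borel_measurable_iff_greater intro!: borel_open)
qed

lemma continuous_on_sections:
  assumes "continuous_on UNIV (\<lambda>(x, w). h x w)"
  shows "continuous_on UNIV (\<lambda>x. h x w)" and "continuous_on UNIV (h x)"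
proof -
  have "continuous_on UNIV (\<lambda>x. (\<lambda>(x, w). h x w) (x, w))"
    by (intro continuous_on_compose2[OF assms] continuous_intros) auto
  then show "continuous_on UNIV (\<lambda>x. h x w)" by simp
  have "continuous_on UNIV (\<lambda>w. (\<lambda>(x, w). h x w) (x, w))"
    by (intro continuous_on_compose2[OF assms] continuous_intros) auto
  then show "continuous_on UNIV (h x)" by simp
qed

text \<open>
  The oscillation controls both the variation of the empirical means and that of the
  expectations within a ball, so one family of auxiliary functions reduces the
  supremum to finitely many empirical means.
\<close>

lemma uniform_empirical_mean_tail:
  fixes h :: "'x::metric_space \<Rightarrow> 'e::topological_space \<Rightarrow> real"
  assumes "prob_space M" and M: "sets M = sets borel" and comp: "compact (UNIV :: 'x set)"
    and cont: "continuous_on UNIV (\<lambda>(x, w). h x w)"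
    and H: "H \<in> borel_measurable borel" "\<And>x w. \<bar>h x w\<bar> \<le> H w"
    and int: "integrable M (\<lambda>w. \<bar>H w\<bar> powr q)" and q: "1 < q" and \<epsilon>: "0 < \<epsilon>"
  shows "polynomially_rare (\<lambda>n. \<Pi>\<^sub>M i\<in>{1..n}. M) (q - 1)
    (\<lambda>n. {\<omega> \<in> space (\<Pi>\<^sub>M i\<in>{1..n}. M).
       \<exists>x. \<epsilon> \<le> \<bar>(\<Sum>i=1..n. h x (\<omega> i)) / real n - (\<integral>w. h x w \<partial>M)\<bar>})"
proof -
  interpret prob_space M by fact
  have meas: "borel_measurable M = (borel_measurable borel :: ('e \<Rightarrow> real) set)"
    by (rule measurable_cong_sets[OF M refl])
  have H_meas [measurable]: "H \<in> borel_measurable M"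
    using H(1) by (simp add: meas)
  have H0: "0 \<le> H w" for w using H(2)[of undefined w] by linarith
  have dominated: "integrable M (\<lambda>w. \<bar>f w\<bar> powr q)"
    if [measurable]: "f \<in> borel_measurable M" and f: "\<And>w. \<bar>f w\<bar> \<le> 2 * H w" for f :: "'e \<Rightarrow> real"
  proof (rule Bochner_Integration.integrable_bound)
    show "integrable M (\<lambda>w. 2 powr q * \<bar>H w\<bar> powr q)" using int by simp
    have "\<bar>f w\<bar> powr q \<le> 2 powr q * \<bar>H w\<bar> powr q" for w
      using powr_mono2[of q "\<bar>f w\<bar>" "2 * H w"] f[of w] H0[of w] q by (simp add: powr_mult)
    then show "AE w in M. norm (\<bar>f w\<bar> powr q) \<le> norm (2 powr q * \<bar>H w\<bar> powr q)" by auto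
  qed simp
  have dominated1: "integrable M f"
    if f [measurable]: "f \<in> borel_measurable M" and le: "\<And>w. \<bar>f w\<bar> \<le> 2 * H w" for f :: "'e \<Rightarrow> real"
  proof -
    have "integrable M (\<lambda>w. \<bar>f w\<bar> powr 1)"
      using q by (intro integrable_powr_mono[OF f dominated[OF f le]]) auto
    then show ?thesis by (intro integrable_abs_cancel[of M f]) auto
  qed
  note contw = continuous_on_sections(2)[OF cont] and contx = continuous_on_sections(1)[OF cont]
  have h_meas [measurable]: "h x \<in> borel_measurable M" for x
    using borel_measurable_continuous_onI[OF contw[of x]] by (simp add: meas)
  have h_le: "\<bar>h x w\<bar> \<le> 2 * H w" for x w using H(2)[of x w] H0[of w] by linarith
  define osc where "osc x r w = (SUP y\<in>ball x r. \<bar>h y w - h x w\<bar>)" for x r w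
  have diff_le: "\<bar>h y w - h x w\<bar> \<le> 2 * H w" for x y w
    using H(2)[of x w] H(2)[of y w] by linarith
  have bdd: "bdd_above ((\<lambda>y. \<bar>h y w - h x w\<bar>) ` S)" for x w S
    by (rule bdd_aboveI2[OF diff_le])
  have osc_upper: "\<bar>h y w - h x w\<bar> \<le> osc x r w" if "y \<in> ball x r" for x y r w
    unfolding osc_def by (rule cSUP_upper[OF that bdd])
  have osc_le: "osc x r w \<le> e" if "0 < r" "\<And>y. dist x y < r \<Longrightarrow> \<bar>h y w - h x w\<bar> \<le> e" for x r w e
    unfolding osc_def using that by (intro cSUP_least) auto
  have osc_nonneg: "0 \<le> osc x r w" if "0 < r" for x r w
    using osc_upper[of x x r w] that by simp
  have osc_bound: "\<bar>osc x r w\<bar> \<le> 2 * H w" if "0 < r" for x r w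
    using osc_nonneg[OF that, of x w] osc_le[OF that diff_le, of x w] by simp
  have osc_meas [measurable]: "osc x r \<in> borel_measurable M" if "0 < r" for x r
  proof -
    have "(\<lambda>w. SUP y\<in>ball x r. \<bar>h y w - h x w\<bar>) \<in> borel_measurable borel"
      using that by (intro borel_measurable_SUP_continuous continuous_intros contw bdd) auto
    then show ?thesis by (simp add: meas osc_def[abs_def])
  qed
  have "\<exists>r>0. (\<integral>w. osc x r w \<partial>M) < \<epsilon> / 8" for x
  proof -
    have "(\<lambda>j. \<integral>w. osc x (1 / real (Suc j)) w \<partial>M) \<longlonglongrightarrow> (\<integral>w. 0 \<partial>M)"
    proof (rule integral_dominated_convergence)
      show "integrable M (\<lambda>w. 2 * H w)" using H0 by (intro dominated1) auto
      show "AE w in M. (\<lambda>j. osc x (1 / real (Suc j)) w) \<longlonglongrightarrow> 0"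
      proof (rule AE_I2, rule LIMSEQ_I)
        fix w and e :: real assume e: "0 < e"
        have "isCont (\<lambda>x. h x w) x" using contx[of w] by (simp add: continuous_on_eq_continuous_at)
        then obtain \<rho> where \<rho>: "0 < \<rho>" "\<And>y. dist y x < \<rho> \<Longrightarrow> dist (h y w) (h x w) < e / 2"
          using e unfolding continuous_at_eps_delta by (metis half_gt_zero)
        obtain N where N: "inverse (real (Suc N)) < \<rho>" using reals_Archimedean[OF \<rho>(1)] by blast
        have "norm (osc x (1 / real (Suc j)) w - 0) < e" if "N \<le> j" for j
        proof -
          have "1 / real (Suc j) \<le> 1 / real (Suc N)" using that by (simp add: field_simps)
          then have "1 / real (Suc j) < \<rho>" using N by (simp add: inverse_eq_divide)
          then have "osc x (1 / real (Suc j)) w \<le> e / 2"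
          proof (intro osc_le)
            fix y assume "dist x y < 1 / real (Suc j)"
            with \<open>1 / real (Suc j) < \<rho>\<close> have "dist y x < \<rho>" by (simp add: dist_commute)
            from \<rho>(2)[OF this] show "\<bar>h y w - h x w\<bar> \<le> e / 2" by (simp add: dist_real_def)
          qed simp
          then show ?thesis using osc_nonneg[of "1 / real (Suc j)" x w] e by simp
        qed
        then show "\<exists>N. \<forall>j\<ge>N. norm (osc x (1 / real (Suc j)) w - 0) < e" by blast
      qed
    qed (use osc_bound in \<open>auto simp del: of_nat_Suc\<close>)
    then have "\<forall>\<^sub>F j in sequentially. (\<integral>w. osc x (1 / real (Suc j)) w \<partial>M) < \<epsilon> / 8"
      using \<epsilon> by (intro order_tendstoD(2)) auto
    then obtain j where "(\<integral>w. osc x (1 / real (Suc j)) w \<partial>M) < \<epsilon> / 8"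
      by (auto simp: eventually_sequentially simp del: of_nat_Suc)
    then show ?thesis by (intro exI[of _ "1 / real (Suc j)"]) simp
  qed
  then obtain r where r: "\<And>x. 0 < r x" "\<And>x. (\<integral>w. osc x (r x) w \<partial>M) < \<epsilon> / 8" by metis
  \<comment> \<open>For \<open>y\<close> in the ball around \<open>x\<close> and \<open>\<omega>\<close> outside the events below, the deviation at \<open>y\<close> is at most
      the empirical mean of the oscillation at the centre
      \<open>x\<close> (below \<open>2 \<epsilon> / 8\<close>), the deviation at \<open>x\<close> and the expected oscillation (each below \<open>\<epsilon> / 8\<close>).\<close>
  obtain T where T: "finite T" "UNIV \<subseteq> (\<Union>x\<in>T. ball x (r x))"
    using r(1) by (rule_tac compactE_image[OF comp, of UNIV "\<lambda>x. ball x (r x)"]) auto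
  let ?P = "\<lambda>n. \<Pi>\<^sub>M i\<in>{1..n::nat}. M"
  let ?D = "\<lambda>Z n. {\<omega> \<in> space (?P n). \<epsilon> / 8 \<le> \<bar>(\<Sum>i=1..n. Z (\<omega> i)) / real n - (\<integral>w. Z w \<partial>M)\<bar>}"
  show ?thesis
  proof (rule polynomially_rare_subset)
    show "polynomially_rare ?P (q - 1) (\<lambda>n. \<Union>x\<in>T. ?D (h x) n \<union> ?D (osc x (r x)) n)"
      using T(1) \<epsilon> r(1) osc_bound h_le
      by (intro polynomially_rare_UN polynomially_rare_Un empirical_mean_tail dominated q) auto
    show "\<forall>\<^sub>F n in sequentially. {\<omega> \<in> space (?P n).
       \<exists>x. \<epsilon> \<le> \<bar>(\<Sum>i=1..n. h x (\<omega> i)) / real n - (\<integral>w. h x w \<partial>M)\<bar>}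
       \<subseteq> (\<Union>x\<in>T. ?D (h x) n \<union> ?D (osc x (r x)) n)"
    proof (intro always_eventually allI subsetI, rule ccontr)
      fix n \<omega>
      assume "\<omega> \<in> {\<omega> \<in> space (?P n).
        \<exists>x. \<epsilon> \<le> \<bar>(\<Sum>i=1..n. h x (\<omega> i)) / real n - (\<integral>w. h x w \<partial>M)\<bar>}"
      then obtain y where \<omega>: "\<omega> \<in> space (?P n)"
        and y: "\<epsilon> \<le> \<bar>(\<Sum>i=1..n. h y (\<omega> i)) / real n - (\<integral>w. h y w \<partial>M)\<bar>" by blast
      obtain x where x: "x \<in> T" "y \<in> ball x (r x)" using T(2) by blast
      assume "\<omega> \<notin> (\<Union>x\<in>T. ?D (h x) n \<union> ?D (osc x (r x)) n)"
      with \<omega> x(1) have hx: "\<bar>(\<Sum>i=1..n. h x (\<omega> i)) / real n - (\<integral>w. h x w \<partial>M)\<bar> < \<epsilon> / 8"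
        and ox: "\<bar>(\<Sum>i=1..n. osc x (r x) (\<omega> i)) / real n - (\<integral>w. osc x (r x) w \<partial>M)\<bar> < \<epsilon> / 8"
        by auto
      have "\<bar>(\<Sum>i=1..n. h y (\<omega> i)) / real n - (\<Sum>i=1..n. h x (\<omega> i)) / real n\<bar>
          = \<bar>\<Sum>i=1..n. h y (\<omega> i) - h x (\<omega> i)\<bar> / real n"
        by (simp add: diff_divide_distrib[symmetric] sum_subtractf)
      also have "\<dots> \<le> (\<Sum>i=1..n. osc x (r x) (\<omega> i)) / real n"
        by (intro divide_right_mono order_trans[OF sum_abs] sum_mono osc_upper x(2)) simp
      finally have emp: "\<bar>(\<Sum>i=1..n. h y (\<omega> i)) / real n - (\<Sum>i=1..n. h x (\<omega> i)) / real n\<bar>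
          \<le> (\<Sum>i=1..n. osc x (r x) (\<omega> i)) / real n" .
      have hi: "integrable M (h z)" for z using h_le by (intro dominated1) auto
      have oi: "integrable M (osc x (r x))" using osc_bound r(1) by (intro dominated1) auto
      have "\<bar>(\<integral>w. h y w \<partial>M) - (\<integral>w. h x w \<partial>M)\<bar> = \<bar>\<integral>w. h y w - h x w \<partial>M\<bar>"
        by (simp add: hi)
      also have "\<dots> \<le> (\<integral>w. \<bar>h y w - h x w\<bar> \<partial>M)" by (rule integral_abs_bound)
      also have "\<dots> \<le> (\<integral>w. osc x (r x) w \<partial>M)"
        using hi oi osc_upper[OF x(2)] by (intro integral_mono) auto
      finally show False using y hx ox emp r(2)[of x] \<epsilon> by linarith
    qed
  qed
qed

section \<open>Integration against the empirical measure\<close>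

text \<open>
  Presenting the empirical measure as the image of the uniform distribution on the indices makes
  integration against it a finite average by change of variables.
\<close>

lemma empirical_measure_eq_distr:
  assumes "0 < n"
  shows "empirical_measure n x = distr (measure_pmf (pmf_of_set {1..n})) borel x"
proof (rule measure_eqI)
  fix A assume "A \<in> sets (empirical_measure n x)"
  then have A: "A \<in> sets borel" by simp
  have "(\<Sum>i=1..n. emeasure (return borel (x i)) A) = (\<Sum>i\<in>{1..n}. indicator (x -` A) i)"
    using A by (intro sum.cong) (auto simp: indicator_def)
  also have "\<dots> = of_nat (card ({1..n} \<inter> x -` A))"
    by (simp add: indicator_def sum.If_cases vimage_def)
  finally have "emeasure (empirical_measure n x) A
      = ennreal (1 / real n) * ennreal (real (card ({1..n} \<inter> x -` A)))"
    using A by (simp add: emeasure_empirical_measure ennreal_of_nat_eq_real_of_nat)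
  also have "\<dots> = ennreal (real (card ({1..n} \<inter> x -` A)) / real n)"
    by (simp add: ennreal_mult[symmetric])
  also have "\<dots> = emeasure (distr (measure_pmf (pmf_of_set {1..n})) borel x) A"
    using A assms by (simp add: emeasure_distr emeasure_pmf_of_set)
  finally show "emeasure (empirical_measure n x) A
      = emeasure (distr (measure_pmf (pmf_of_set {1..n})) borel x) A" .
qed simp

lemma integral_empirical_measure:
  fixes f :: "'e::topological_space \<Rightarrow> real"
  assumes "0 < n" and f: "f \<in> borel_measurable borel"
  shows "(\<integral>w. f w \<partial>empirical_measure n x) = (\<Sum>i=1..n. f (x i)) / real n"
  using assms
  by (simp add: empirical_measure_eq_distr integral_distr integral_pmf_of_set)

lemma empirical_measure_in_prob_with_moment:
  assumes "0 < n" and f: "\<psi> \<in> borel_measurable borel"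
  shows "empirical_measure n x \<in> prob_with_moment \<psi>"
proof -
  have "prob_space (empirical_measure n x)"
    unfolding empirical_measure_eq_distr[OF \<open>0 < n\<close>]
    by (rule prob_space.prob_space_distr) (auto simp: measure_pmf.prob_space_axioms)
  moreover have "integrable (empirical_measure n x) \<psi>"
    unfolding empirical_measure_eq_distr[OF \<open>0 < n\<close>] using assms
    by (subst integrable_distr_eq) (auto intro!: integrable_measure_pmf_finite)
  then have "(\<integral>\<^sup>+ w. ennreal (norm (\<psi> w)) \<partial>empirical_measure n x) < \<infinity>"
    by (simp add: integrable_iff_bounded)
  then have "(\<integral>\<^sup>+ w. ennreal (\<psi> w) \<partial>empirical_measure n x) < \<infinity>"
    by (rule le_less_trans[rotated]) (auto intro!: nn_integral_mono ennreal_leI)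
  ultimately show ?thesis
    by (simp add: prob_with_moment_def space_prob_algebra)
qed

section \<open>Deviations of the empirical minimiser\<close>

theorem theorem4p5:
  fixes h :: "'x::polish_space \<Rightarrow> 'e::polish_space \<Rightarrow> real"
    and \<mu> :: "'e measure"
    and q :: real
    and xhat :: "'e measure \<Rightarrow> 'x"
    and \<phi> :: "real \<Rightarrow> real"
    and d :: "'x \<Rightarrow> 'x \<Rightarrow> real"
  assumes "compact (UNIV :: 'x set)"
    and "continuous_on UNIV (\<lambda>(x, w). h x w)"
    and "\<exists>b. \<forall>x w. b \<le> h x w"
    and "\<And>c. compact {(x, w). h x w \<le> c}"
    and "1 < q"
    and "\<mu> \<in> space (prob_algebra borel)"
    and "(\<integral>\<^sup>+ w. ennreal (pos_sup h w powr q) \<partial>\<mu>) < \<infinity>"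
    and "xhat \<in> psi_borel (pos_sup h) \<rightarrow>\<^sub>M borel"
    and "\<And>\<nu>. \<nu> \<in> prob_with_moment (pos_sup h) \<Longrightarrow>
           is_arg_min (\<lambda>x. \<integral>w. h x w \<partial>\<nu>) (\<lambda>x. x \<in> UNIV) (xhat \<nu>)"
    and "\<phi> \<in> borel_measurable borel"
    and "Metric_space UNIV d"
    and "Metric_space.mtopology UNIV d = euclidean"
    and "\<And>x. \<phi> (d (xhat \<mu>) x) \<le> (\<integral>w. h x w \<partial>\<mu>) - (\<integral>w. h (xhat \<mu>) w \<partial>\<mu>)"
  shows "(\<forall>\<epsilon>>0. limsup (\<lambda>n. ereal (real n powr (q - 1) *
             measure (\<Pi>\<^sub>M i\<in>{1..n}. \<mu>)
               {\<omega> \<in> space (\<Pi>\<^sub>M i\<in>{1..n}. \<mu>).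
                  \<phi> (d (xhat \<mu>) (xhat (empirical_measure n \<omega>))) \<ge> \<epsilon>})) < \<infinity>) \<and>
         (strict_mono \<phi> \<and> \<phi> 0 = 0 \<longrightarrow>
         (\<forall>\<epsilon>>0. limsup (\<lambda>n. ereal (real n powr (q - 1) *
             measure (\<Pi>\<^sub>M i\<in>{1..n}. \<mu>)
               {\<omega> \<in> space (\<Pi>\<^sub>M i\<in>{1..n}. \<mu>).
                  d (xhat \<mu>) (xhat (empirical_measure n \<omega>)) \<ge> \<epsilon>})) < \<infinity>))"
proof -
  note comp = assms(1) and cont = assms(2) and q = assms(5) and argmin = assms(9)
    and phi_le = assms(13)
  obtain b where b: "\<And>x w. b \<le> h x w" using assms(3) by blast
  have M: "sets \<mu> = sets borel" "prob_space \<mu>"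
    using assms(6) by (auto simp: space_prob_algebra)
  have meas: "borel_measurable \<mu> = (borel_measurable borel :: ('e \<Rightarrow> real) set)"
    by (rule measurable_cong_sets[OF M(1) refl])
  interpret prob_space \<mu> by fact
  let ?\<psi> = "pos_sup h"
  note contw = continuous_on_sections(2)[OF cont] and contx = continuous_on_sections(1)[OF cont]
  have bdd: "bdd_above (range (\<lambda>x. h x w))" for w
    using compact_continuous_image[OF contx comp] by (intro bounded_imp_bdd_above compact_imp_bounded)
  have psi_meas: "?\<psi> \<in> borel_measurable borel"
    unfolding pos_sup_def[abs_def]
    by (intro borel_measurable_max borel_measurable_SUP_continuous contw bdd) auto
  then have [measurable]: "?\<psi> \<in> borel_measurable \<mu>" by (simp add: meas)
  have psi0: "0 \<le> ?\<psi> w" and h_le: "h x w \<le> ?\<psi> w" for x w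
    using cSUP_upper[OF UNIV_I bdd, of x w] by (auto simp: pos_sup_def)
  define H where "H w = ?\<psi> w + \<bar>b\<bar>" for w
  have H_meas: "H \<in> borel_measurable borel"
    using psi_meas unfolding H_def[abs_def] by (intro borel_measurable_add) auto
  then have [measurable]: "H \<in> borel_measurable \<mu>" by (simp add: meas)
  have H_bound: "\<bar>h x w\<bar> \<le> H w" for x w
    using b[of x w] h_le[of x w] psi0[of w] unfolding H_def by linarith
  have psi_int: "integrable \<mu> (\<lambda>w. ?\<psi> w powr q)"
    using assms(7) by (intro integrableI_bounded) auto
  have H_int: "integrable \<mu> (\<lambda>w. \<bar>H w\<bar> powr q)"
  proof (rule Bochner_Integration.integrable_bound)
    show "integrable \<mu> (\<lambda>w. 2 powr q * (?\<psi> w powr q + \<bar>b\<bar> powr q))"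
      using psi_int by simp
    have "\<bar>H w\<bar> powr q \<le> 2 powr q * (?\<psi> w powr q + \<bar>b\<bar> powr q)" for w
    proof -
      have "\<bar>H w\<bar> powr q \<le> (2 * max (?\<psi> w) \<bar>b\<bar>) powr q"
        using q psi0[of w] by (intro powr_mono2) (auto simp: H_def)
      also have "\<dots> = 2 powr q * max (?\<psi> w) \<bar>b\<bar> powr q"
        using psi0[of w] by (simp add: powr_mult)
      also have "\<dots> \<le> 2 powr q * (?\<psi> w powr q + \<bar>b\<bar> powr q)"
        by (intro mult_left_mono) (auto simp: max_def)
      finally show ?thesis .
    qed
    then show "AE w in \<mu>. norm (\<bar>H w\<bar> powr q) \<le> norm (2 powr q * (?\<psi> w powr q + \<bar>b\<bar> powr q))"
      by (auto intro!: AE_I2)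
  qed simp
  let ?P = "\<lambda>n. \<Pi>\<^sub>M i\<in>{1..n::nat}. \<mu>"
  let ?F = "\<lambda>x. \<integral>w. h x w \<partial>\<mu>" and ?Fn = "\<lambda>n \<omega> x. (\<Sum>i=1..n. h x (\<omega> i)) / real n"
  have fin: "finite_measure (?P n)" for n
    using prob_space_PiM[of "{1..n}" "\<lambda>_. \<mu>"] M(2) by (simp add: prob_space_def)
  have rare: "polynomially_rare ?P (q - 1)
      (\<lambda>n. {\<omega> \<in> space (?P n). \<phi> (d (xhat \<mu>) (xhat (empirical_measure n \<omega>))) \<ge> \<epsilon>})"
    if \<epsilon>: "0 < \<epsilon>" for \<epsilon>
  proof (rule polynomially_rare_subset)
    show "polynomially_rare ?P (q - 1)
      (\<lambda>n. {\<omega> \<in> space (?P n). \<exists>x. \<epsilon> / 2 \<le> \<bar>?Fn n \<omega> x - ?F x\<bar>})"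
      using \<epsilon> by (intro uniform_empirical_mean_tail[OF M(2,1) comp cont H_meas H_bound H_int q]) simp
    show "\<forall>\<^sub>F n in sequentially.
        {\<omega> \<in> space (?P n). \<phi> (d (xhat \<mu>) (xhat (empirical_measure n \<omega>))) \<ge> \<epsilon>}
        \<subseteq> {\<omega> \<in> space (?P n). \<exists>x. \<epsilon> / 2 \<le> \<bar>?Fn n \<omega> x - ?F x\<bar>}"
      using eventually_gt_at_top[of 0]
    proof eventually_elim
      case (elim n)
      show ?case
      proof safe
        fix \<omega> assume *: "\<phi> (d (xhat \<mu>) (xhat (empirical_measure n \<omega>))) \<ge> \<epsilon>"
        let ?xn = "xhat (empirical_measure n \<omega>)"
        have "\<epsilon> \<le> ?F ?xn - ?F (xhat \<mu>)"
          using * phi_le[of ?xn] by linarith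
        moreover have "\<not> ?Fn n \<omega> (xhat \<mu>) < ?Fn n \<omega> ?xn"
          using argmin[OF empirical_measure_in_prob_with_moment[OF elim psi_meas, of \<omega>]]
          unfolding is_arg_min_def
          by (simp add: integral_empirical_measure[OF elim] borel_measurable_continuous_onI contw)
        ultimately have "\<epsilon> / 2 \<le> \<bar>?Fn n \<omega> ?xn - ?F ?xn\<bar>
            \<or> \<epsilon> / 2 \<le> \<bar>?Fn n \<omega> (xhat \<mu>) - ?F (xhat \<mu>)\<bar>"
          by linarith
        then show "\<exists>x. \<epsilon> / 2 \<le> \<bar>?Fn n \<omega> x - ?F x\<bar>" by blast
      qed
    qed
  qed
  show ?thesis
  proof (intro conjI impI allI)
    fix \<epsilon> :: real assume "0 < \<epsilon>"
    then show "limsup (\<lambda>n. ereal (real n powr (q - 1) * measure (?P n) {\<omega> \<in> space (?P n).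
                  \<phi> (d (xhat \<mu>) (xhat (empirical_measure n \<omega>))) \<ge> \<epsilon>})) < \<infinity>"
      by (intro polynomially_rare_imp_limsup_finite fin rare)
  next
    fix \<epsilon> :: real assume \<epsilon>: "0 < \<epsilon>" and phi: "strict_mono \<phi> \<and> \<phi> 0 = 0"
    have "0 < \<phi> \<epsilon>" using phi \<epsilon> strict_monoD[of \<phi> 0 \<epsilon>] by simp
    then have "polynomially_rare ?P (q - 1)
      (\<lambda>n. {\<omega> \<in> space (?P n). \<phi> (d (xhat \<mu>) (xhat (empirical_measure n \<omega>))) \<ge> \<phi> \<epsilon>})"
      by (rule rare)
    also have "(\<lambda>n. {\<omega> \<in> space (?P n). \<phi> (d (xhat \<mu>) (xhat (empirical_measure n \<omega>))) \<ge> \<phi> \<epsilon>})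
      = (\<lambda>n. {\<omega> \<in> space (?P n). d (xhat \<mu>) (xhat (empirical_measure n \<omega>)) \<ge> \<epsilon>})"
      using phi by (simp add: strict_mono_less_eq)
    finally show "limsup (\<lambda>n. ereal (real n powr (q - 1) * measure (?P n) {\<omega> \<in> space (?P n).
                  d (xhat \<mu>) (xhat (empirical_measure n \<omega>)) \<ge> \<epsilon>})) < \<infinity>"
      by (intro polynomially_rare_imp_limsup_finite fin)
  qed
qed

end
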